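(* Let $G$ be a connected graph of order $n \ge 3$, and let $f: V(G_1) \rightarrow V(G_2)$ be any function. Then $2 \le \dim(C(G, f)) \le 2n-3$. Both bounds are sharp, i.e., each bound is attained with equality by $\dim(C(G,f))$ for some connected graph $G$ of order $n\ge 3$ and some function $f$.
   Context: All graphs are simple, undirected, and connected. For a connected graph $H$, a set $S \subseteq V(H)$ is a resolving set if for every two distinct vertices $x,y$ of $H$ there is $s \in S$ with $d_H(x,s) \neq d_H(y,s)$; the metric dimension $\dim(H)$ is the minimum cardinality of a resolving set of $H$. Given a graph $G$, let $G_1$ and $G_2$ be disjoint copies of $G$ and let $f: V(G_1)\to V(G_2)$ be a function. The functigraph $C(G,f)$ is the graph with vertex set $V(G_1)\cup V(G_2)$ and edge set $E(G_1)\cup E(G_2)\cup\{uv \mid u \in V(G_1),\ v=f(u)\}$. *)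

theory Defs
  imports "Graph_Theory.Graph_Theory"
begin

text \<open>Finite simple undirected graphs are the instances of \<^locale>\<open>pair_graph\<close>: an undirected edge
  is represented by its two opposite arcs.\<close>

definition graph_dist :: "'a pair_pre_digraph \<Rightarrow> 'a \<Rightarrow> 'a \<Rightarrow> ereal" where
  "graph_dist H x y = wf_digraph.\<mu> (with_proj H) (\<lambda>_. 1) x y"

definition resolving_set :: "'a pair_pre_digraph \<Rightarrow> 'a set \<Rightarrow> bool" where
  "resolving_set H S \<longleftrightarrow> S \<subseteq> pverts H \<and>
     (\<forall>x\<in>pverts H. \<forall>y\<in>pverts H. x \<noteq> y \<longrightarrow> (\<exists>s\<in>S. graph_dist H x s \<noteq> graph_dist H y s))"

definition metric_dim :: "'a pair_pre_digraph \<Rightarrow> nat" where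
  "metric_dim H = (LEAST k. \<exists>S. finite S \<and> resolving_set H S \<and> card S = k)"

text \<open>The two disjoint copies of \<open>G\<close> are the \<^const>\<open>Inl\<close>- and the \<^const>\<open>Inr\<close>-tagged vertices, so a
  function from the first copy to the second is a map of \<^term>\<open>pverts G\<close> into itself.\<close>

definition functigraph :: "'a pair_pre_digraph \<Rightarrow> ('a \<Rightarrow> 'a) \<Rightarrow> ('a + 'a) pair_pre_digraph" where
  "functigraph G f = \<lparr>
     pverts = pverts G <+> pverts G,
     parcs = {(Inl u, Inl v) | u v. (u, v) \<in> parcs G} \<union> {(Inr u, Inr v) | u v. (u, v) \<in> parcs G}
       \<union> {(Inl u, Inr (f u)) | u. u \<in> pverts G} \<union> {(Inr (f u), Inl u) | u. u \<in> pverts G} \<rparr>"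

lemma pair_graph_functigraph:
  assumes "pair_graph G" and f: "f \<in> pverts G \<rightarrow> pverts G"
  shows "pair_graph (functigraph G f)"
proof -
  interpret pair_graph G by fact
  have wf: "fst e \<in> pverts (functigraph G f) \<and> snd e \<in> pverts (functigraph G f)"
    if "e \<in> parcs (functigraph G f)" for e
    using that f by (auto simp: functigraph_def dest: in_arcsD1 in_arcsD2)
  have fin: "finite (pverts (functigraph G f))"
    using pair_finite_verts by (simp add: functigraph_def)
  have "parcs (functigraph G f) \<subseteq> pverts (functigraph G f) \<times> pverts (functigraph G f)"
    using wf by (metis mem_Times_iff subsetI)
  then have fina: "finite (parcs (functigraph G f))"
    using fin by (meson finite_SigmaI finite_subset)
  have "sym (parcs (functigraph G f))"
    by (rule symI) (auto simp: functigraph_def intro: arcs_symmetric)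
  moreover have "fst e \<noteq> snd e" if "e \<in> parcs (functigraph G f)" for e
    using that pair_no_loops by (auto simp: functigraph_def)
  ultimately show ?thesis
    using wf fin fina by unfold_locales (auto simp: symmetric_def)
qed

end

theory Submission
  imports Defs
begin

text \<open>A graph resolved by a single vertex has maximum degree at most \<open>2\<close>, whereas a vertex of degree at
  least \<open>2\<close> in \<open>G\<close> gains a further neighbour in the functigraph. For the upper bound it suffices to
  find three vertices that are pairwise separated by adjacency to some fourth vertex; which three
  depends on whether \<open>f\<close> takes one, two or at least three values. The bounds are attained on the
  triangle: the identity gives the prism, and a constant map gives a class of three twins and a
  class of two twins, each of which a resolving set meets in all but at most one vertex.\<close>

section \<open>Distances and resolving sets\<close>

context pair_wf_digraph
begin

lemma awalk_cost_one: "awalk_cost (\<lambda>_. 1) p = real (length p)"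
  by (induct p) auto

lemma graph_dist_le_length: "awalk x p y \<Longrightarrow> graph_dist G x y \<le> real (length p)"
  unfolding graph_dist_def using min_cost_le_walk_cost[of x p y "\<lambda>_. 1"]
  by (simp add: awalk_cost_one)

text \<open>Walk lengths are natural numbers, so the infimum over a nonempty set of walks is
  attained; over the empty set it is \<infinity>. This moves later arguments from
  \<open>ereal\<close> to \<open>nat\<close>.\<close>

lemma graph_dist_cases:
  obtains "graph_dist G x y = \<infinity>"
  | p where "awalk x p y" "graph_dist G x y = real (length p)"
proof (cases "\<exists>p. awalk x p y")
  case False
  then have "graph_dist G x y = \<infinity>"
    unfolding graph_dist_def by (intro shortest_path_inf) (simp add: reachable_awalk)
  then show ?thesis by (rule that(1))
next
  case True
  then obtain p where p: "awalk x p y" and min: "\<And>q. awalk x q y \<Longrightarrow> length p \<le> length q"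
    using ex_has_least_nat[of "\<lambda>p. awalk x p y" _ length] by blast
  have "real (length p) \<le> graph_dist G x y"
    unfolding graph_dist_def \<mu>_def by (intro INF_greatest) (auto simp: awalk_cost_one min)
  with graph_dist_le_length[OF p] p show ?thesis by (intro that(2)) auto
qed

text \<open>Only the empty walk has length 0, and it exists only at vertices: outside the graph the
  distance from \<open>x\<close> to itself is \<infinity>.\<close>

lemma graph_dist_eq_0_iff:
  assumes "x \<in> pverts G"
  shows "graph_dist G x y = 0 \<longleftrightarrow> x = y"
proof
  assume "graph_dist G x y = 0"
  then show "x = y"
    by (cases x y rule: graph_dist_cases) (auto simp: awalk_simps)
next
  assume "x = y"
  with assms have "awalk x [] y" by (simp add: awalk_simps)
  then show "graph_dist G x y = 0"
    using graph_dist_le_length[of x "[]" y]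
    by (cases x y rule: graph_dist_cases) auto
qed

lemma graph_dist_arc:
  assumes "(x, y) \<in> parcs G"
  shows "graph_dist G x s \<le> graph_dist G y s + 1"
proof (cases y s rule: graph_dist_cases)
  case (2 p)
  with assms have "awalk x ((x, y) # p) s" by (simp add: awalk_simps)
  from graph_dist_le_length[OF this] 2 show ?thesis by (simp add: add.commute)
qed simp

text \<open>A walk of length one is a single arc. Conversely, an arc bounds the distance by 1,
  distinctness rules out 0, and integrality leaves 1. At \<open>x = y\<close> a loop would still
  give distance 0.\<close>

lemma graph_dist_eq_1_iff:
  assumes "x \<noteq> y"
  shows "graph_dist G x y = 1 \<longleftrightarrow> (x, y) \<in> parcs G"
proof
  assume "graph_dist G x y = 1"
  then show "(x, y) \<in> parcs G"
  proof (cases x y rule: graph_dist_cases)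
    case (2 p)
    with \<open>graph_dist G x y = 1\<close> have "length p = 1" by simp
    with 2 show ?thesis by (auto simp: length_Suc_conv awalk_simps)
  qed simp
next
  assume arc: "(x, y) \<in> parcs G"
  then have le: "graph_dist G x y \<le> 1"
    using graph_dist_arc[of x y y] graph_dist_eq_0_iff[of y y] in_arcsD2 by auto
  have "graph_dist G x y \<noteq> 0"
    using arc assms graph_dist_eq_0_iff in_arcsD1 by blast
  with le show "graph_dist G x y = 1"
  proof (cases x y rule: graph_dist_cases)
    case (2 p)
    with le \<open>graph_dist G x y \<noteq> 0\<close> have "length p \<le> 1" "length p \<noteq> 0" by auto
    with 2 show ?thesis by (simp add: le_Suc_eq)
  qed simp
qed

section \<open>Resolving sets, adjacency and twins\<close>

lemma resolving_set_adjI: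
  assumes "S \<subseteq> pverts G"
    and adj: "\<And>x y. x \<in> pverts G - S \<Longrightarrow> y \<in> pverts G - S \<Longrightarrow> x \<noteq> y \<Longrightarrow>
      \<exists>s\<in>S. ((x, s) \<in> parcs G) \<noteq> ((y, s) \<in> parcs G)"
  shows "resolving_set G S"
  unfolding resolving_set_def
proof (intro conjI ballI impI)
  fix x y assume xy: "x \<in> pverts G" "y \<in> pverts G" "x \<noteq> y"
  show "\<exists>s\<in>S. graph_dist G x s \<noteq> graph_dist G y s"
  \<comment> \<open>A member of \<open>S\<close> resolves itself from every other vertex by distance
    0; outside \<open>S\<close>, distance 1 detects adjacency.\<close>
  proof (cases "x \<in> S \<or> y \<in> S")
    case True
    then show ?thesis using xy graph_dist_eq_0_iff by metis
  next
    case False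
    then obtain s where "s \<in> S" "((x, s) \<in> parcs G) \<noteq> ((y, s) \<in> parcs G)"
      using adj xy by blast
    moreover from this False have "x \<noteq> s" "y \<noteq> s" by auto
    ultimately show ?thesis using graph_dist_eq_1_iff by metis
  qed
qed fact

text \<open>Take a shortest walk from \<open>y\<close> to \<open>s\<close>, which is nonempty since
  \<open>s \<noteq> y\<close>. Its first arc can be replaced by one starting in \<open>x\<close>, or
  dropped if it already leads to \<open>x\<close>.\<close>

lemma graph_dist_twin_le:
  assumes twin: "\<And>z. z \<noteq> x \<Longrightarrow> (y, z) \<in> parcs G \<Longrightarrow> (x, z) \<in> parcs G" and "s \<noteq> y"
  shows "graph_dist G x s \<le> graph_dist G y s"
proof (cases y s rule: graph_dist_cases)
  case (2 p)
  with \<open>s \<noteq> y\<close> obtain z q where p: "p = (y, z) # q" "(y, z) \<in> parcs G" and q: "awalk z q s"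
    by (cases p) (auto simp: awalk_simps)
  have "graph_dist G x s \<le> real (length p)"
  proof (cases "z = x")
    case True
    have "graph_dist G x s \<le> real (length q)"
      using graph_dist_le_length[OF q] True by simp
    also have "\<dots> \<le> real (length p)" using p by simp
    finally show ?thesis by simp
  next
    case False
    then have "awalk x ((x, z) # q) s" using twin p q by (simp add: awalk_simps)
    from graph_dist_le_length[OF this] p show ?thesis by simp
  qed
  with 2 show ?thesis by simp
qed simp

text \<open>Twins have equal distance to every vertex other than themselves. Nothing is said about
  an arc between \<open>x\<close> and \<open>y\<close>, so adjacent and non-adjacent twins are both
  covered.\<close>

lemma resolving_set_twin:
  assumes S: "resolving_set G S" and xy: "x \<in> pverts G" "y \<in> pverts G" "x \<noteq> y"
    and twin: "\<And>z. z \<noteq> x \<Longrightarrow> z \<noteq> y \<Longrightarrow> (x, z) \<in> parcs G \<longleftrightarrow> (y, z) \<in> parcs G"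
    and noloop: "(x, x) \<notin> parcs G" "(y, y) \<notin> parcs G"
  shows "x \<in> S \<or> y \<in> S"
proof (rule ccontr)
  assume "\<not> ?thesis"
  then have notin: "x \<notin> S" "y \<notin> S" by auto
  obtain s where s: "s \<in> S" "graph_dist G x s \<noteq> graph_dist G y s"
    using S xy unfolding resolving_set_def by blast
  with notin have "s \<noteq> x" "s \<noteq> y" by auto
  \<comment> \<open>The one-sided twin condition also ranges over the start vertex itself; there its
    premise is a loop, hence false.\<close>
  then have "graph_dist G x s = graph_dist G y s"
    using twin noloop by (intro antisym graph_dist_twin_le) metis+
  with s show False by simp
qed

end

section \<open>General bounds on the metric dimension\<close>

lemma metric_dim_le:
  assumes "resolving_set H S" "finite S"
  shows "metric_dim H \<le> card S"
  unfolding metric_dim_def using assms by (intro Least_le) auto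

text \<open>The full vertex set resolves, so the \<open>LEAST\<close> in the definition is attained
  by an actual resolving set.\<close>

lemma (in pair_fin_digraph) metric_dim_ge:
  assumes "\<And>S. finite S \<Longrightarrow> resolving_set G S \<Longrightarrow> k \<le> card S"
  shows "k \<le> metric_dim G"
proof -
  have "resolving_set G (pverts G)"
    by (rule resolving_set_adjI) auto
  then have "\<exists>S. finite S \<and> resolving_set G S \<and> card S = card (pverts G)"
    using pair_finite_verts by blast
  from LeastI[of "\<lambda>k. \<exists>S. finite S \<and> resolving_set G S \<and> card S = k", OF this]
  show ?thesis using assms unfolding metric_dim_def by metis
qed

text \<open>The complement of the triple is the resolving set, which is why the separating vertices
  must lie outside the triple.\<close>

lemma (in pair_fin_digraph) metric_dim_le_card_diff_3:
  assumes xyz: "x \<in> pverts G" "y \<in> pverts G" "z \<in> pverts G" "x \<noteq> y" "x \<noteq> z" "y \<noteq> z"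
    and "\<exists>s\<in>pverts G - {x, y, z}. ((x, s) \<in> parcs G) \<noteq> ((y, s) \<in> parcs G)"
    and "\<exists>s\<in>pverts G - {x, y, z}. ((x, s) \<in> parcs G) \<noteq> ((z, s) \<in> parcs G)"
    and "\<exists>s\<in>pverts G - {x, y, z}. ((y, s) \<in> parcs G) \<noteq> ((z, s) \<in> parcs G)"
  shows "metric_dim G \<le> card (pverts G) - 3"
proof -
  have "resolving_set G (pverts G - {x, y, z})"
  proof (rule resolving_set_adjI)
    fix a b assume "a \<in> pverts G - (pverts G - {x, y, z})" "b \<in> pverts G - (pverts G - {x, y, z})" "a \<noteq> b"
    then consider "a = x" "b = y" | "a = y" "b = x" | "a = x" "b = z" | "a = z" "b = x"
      | "a = y" "b = z" | "a = z" "b = y" by auto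
    then show "\<exists>s\<in>pverts G - {x, y, z}. ((a, s) \<in> parcs G) \<noteq> ((b, s) \<in> parcs G)"
      using assms(7-9) by cases metis+
  qed auto
  then have "metric_dim G \<le> card (pverts G - {x, y, z})"
    using pair_finite_verts by (intro metric_dim_le) auto
  also have "\<dots> = card (pverts G) - 3"
    using xyz by (subst card_Diff_subset) auto
  finally show ?thesis .
qed

text \<open>Distances to a fixed vertex change by at most one along an arc, so they take at most three
  values on a closed neighbourhood.\<close>

lemma (in pair_graph) not_resolving_set_singleton:
  assumes nbr: "(x, a) \<in> parcs G" "(x, b) \<in> parcs G" "(x, c) \<in> parcs G"
    and ne: "a \<noteq> b" "a \<noteq> c" "b \<noteq> c"
  shows "\<not> resolving_set G {s}"
proof
  assume "resolving_set G {s}"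
  then have inj: "u = v" if "u \<in> pverts G" "v \<in> pverts G" "graph_dist G u s = graph_dist G v s" for u v
    using that unfolding resolving_set_def by blast
  have V: "x \<in> pverts G" "a \<in> pverts G" "b \<in> pverts G" "c \<in> pverts G"
    using nbr in_arcsD1 in_arcsD2 by blast+
  have xne: "x \<noteq> a" "x \<noteq> b" "x \<noteq> c" using nbr pair_no_loops by fastforce+
  have sym: "(a, x) \<in> parcs G" "(b, x) \<in> parcs G" "(c, x) \<in> parcs G"
    using nbr arcs_symmetric by blast+
  \<comment> \<open>Since \<open>s\<close> resolves everything, adjacent vertices have different
    distances to it, so along an arc a finite distance changes by exactly one.\<close>
  have step: "\<exists>m. graph_dist G v s = real m \<and> m \<le> n + 1 \<and> n \<le> m + 1 \<and> m \<noteq> n"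
    if "(x, v) \<in> parcs G" "(v, x) \<in> parcs G" "x \<noteq> v" "graph_dist G x s = real n" for v n
  proof (cases v s rule: graph_dist_cases)
    case 1
    then show ?thesis using graph_dist_arc[OF that(2), of s] that(4) by simp
  next
    case (2 p)
    have "graph_dist G v s \<noteq> graph_dist G x s" using inj that in_arcsD1 by metis
    with 2 graph_dist_arc[OF that(1), of s] graph_dist_arc[OF that(2), of s] that(4)
    show ?thesis by (intro exI[of _ "length p"]) auto
  qed
  show False
  proof (cases x s rule: graph_dist_cases)
    \<comment> \<open>The graph is not assumed connected here: if \<open>x\<close> does not reach
      \<open>s\<close>, neither does its neighbour \<open>a\<close>, and \<open>s\<close> fails to
      resolve the two.\<close>
    case 1
    then have "graph_dist G a s = \<infinity>" using graph_dist_arc[OF nbr(1), of s]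
      by (cases "graph_dist G a s") auto
    with 1 inj V xne show False by metis
  next
    case (2 p)
    obtain i j k where d: "graph_dist G a s = real i" "graph_dist G b s = real j" "graph_dist G c s = real k"
      and bnd: "i \<le> length p + 1" "length p \<le> i + 1" "i \<noteq> length p"
        "j \<le> length p + 1" "length p \<le> j + 1" "j \<noteq> length p"
        "k \<le> length p + 1" "length p \<le> k + 1" "k \<noteq> length p"
      using step[OF nbr(1) sym(1) xne(1) 2(2)] step[OF nbr(2) sym(2) xne(2) 2(2)]
        step[OF nbr(3) sym(3) xne(3) 2(2)] by blast
    \<comment> \<open>Pigeonhole: three neighbours share the two values \<open>length p - 1\<close>
      and \<open>length p + 1\<close>.\<close>
    from bnd have "i = j \<or> i = k \<or> j = k" by linarith
    then show False using d inj V ne by metis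
  qed
qed

text \<open>Connectedness yields a directed walk from \<open>u\<close> to \<open>v\<close> because
  the arcs are symmetric; the walk must leave \<open>A\<close> somewhere.\<close>

lemma (in pair_graph) connected_crossing_arc:
  assumes "connected (with_proj G)" "u \<in> A" "u \<in> pverts G" "v \<notin> A" "v \<in> pverts G"
  obtains x y where "(x, y) \<in> parcs G" "x \<in> A" "y \<notin> A"
proof -
  have "strongly_connected (with_proj G)"
    using pair_sym_arcs assms(1) by (rule symmetric_connected_imp_strongly_connected)
  then have "u \<rightarrow>\<^sup>*\<^bsub>with_proj G\<^esub> v"
    using assms(3,5) unfolding strongly_connected_def by simp
  then have "\<exists>x y. (x, y) \<in> parcs G \<and> x \<in> A \<and> y \<notin> A"
    using assms(2,4)
    by (induct rule: reachable_induct) (auto simp: adj_in_verts)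
  then show ?thesis using that by blast
qed

section \<open>Functigraphs\<close>

lemma pverts_functigraph: "pverts (functigraph G f) = Inl ` pverts G \<union> Inr ` pverts G"
  by (auto simp: functigraph_def)

lemma parcs_functigraph [simp]:
  "(Inl u, Inl v) \<in> parcs (functigraph G f) \<longleftrightarrow> (u, v) \<in> parcs G"
  "(Inr u, Inr v) \<in> parcs (functigraph G f) \<longleftrightarrow> (u, v) \<in> parcs G"
  "(Inl u, Inr v) \<in> parcs (functigraph G f) \<longleftrightarrow> u \<in> pverts G \<and> v = f u"
  "(Inr v, Inl u) \<in> parcs (functigraph G f) \<longleftrightarrow> u \<in> pverts G \<and> v = f u"
  by (auto simp: functigraph_def)

locale functi = pair_graph G for G :: "'a pair_pre_digraph" +
  fixes f :: "'a \<Rightarrow> 'a"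
  assumes conn: "connected (with_proj G)" and card_ge_3: "3 \<le> card (pverts G)"
    and f_fun: "f \<in> pverts G \<rightarrow> pverts G"
begin

sublocale C: pair_graph "functigraph G f"
  using pair_graph_functigraph f_fun by blast

lemma f_in [simp]: "u \<in> pverts G \<Longrightarrow> f u \<in> pverts G"
  using f_fun by auto

lemma card_pverts_functigraph: "card (pverts (functigraph G f)) = 2 * card (pverts G)"
  unfolding functigraph_def using pair_finite_verts by (simp add: card_Plus)

lemma third_vertex: obtains t where "t \<in> pverts G" "t \<noteq> x" "t \<noteq> y"
proof -
  have "\<not> pverts G \<subseteq> {x, y}"
    using card_ge_3 card_mono[of "{x, y}" "pverts G"] card_insert_le_m1[of 2 "{y}" x] by force
  then show ?thesis using that by blast
qed

lemma neighbour:
  assumes "u \<in> pverts G"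
  obtains v where "(u, v) \<in> parcs G" "(v, u) \<in> parcs G" "v \<in> pverts G" "v \<noteq> u"
proof -
  obtain t where "t \<in> pverts G" "t \<noteq> u" by (rule third_vertex)
  with assms obtain x y where "(x, y) \<in> parcs G" "x \<in> {u}" "y \<notin> {u}"
    using connected_crossing_arc[OF conn, of u "{u}" t] by blast
  then show ?thesis using that[of y] arcs_symmetric in_arcsD2 by blast
qed

text \<open>An edge does not exhaust the vertices, so some arc leaves it; the endpoint where it
  starts has two neighbours.\<close>

lemma vertex_degree_ge_2:
  obtains x a b where "(x, a) \<in> parcs G" "(x, b) \<in> parcs G" "a \<noteq> b" "x \<in> pverts G"
proof -
  obtain x where x: "x \<in> pverts G" by (rule third_vertex)
  then obtain y where y: "(x, y) \<in> parcs G" "(y, x) \<in> parcs G" "y \<in> pverts G" by (rule neighbour)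
  obtain t where "t \<in> pverts G" "t \<noteq> x" "t \<noteq> y" by (rule third_vertex)
  with x obtain u z where uz: "(u, z) \<in> parcs G" "u \<in> {x, y}" "z \<notin> {x, y}"
    using connected_crossing_arc[OF conn, of x "{x, y}" t] by blast
  then show ?thesis using that[of x y z] that[of y x z] x y by auto
qed

section \<open>The lower bound\<close>

lemma metric_dim_functigraph_ge_2: "2 \<le> metric_dim (functigraph G f)"
proof (rule C.metric_dim_ge)
  fix S assume S: "finite S" "resolving_set (functigraph G f) S"
  obtain x a b where xab: "(x, a) \<in> parcs G" "(x, b) \<in> parcs G" "a \<noteq> b" "x \<in> pverts G"
    by (rule vertex_degree_ge_2)
  \<comment> \<open>The third neighbour of \<open>Inl x\<close> is its image in the other
    copy.\<close>
  have "\<not> resolving_set (functigraph G f) {s}" for s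
    using xab by (intro C.not_resolving_set_singleton[of "Inl x" "Inl a" "Inl b" "Inr (f x)"]) auto
  then have "card S \<noteq> 1" using S by (auto simp: card_1_singleton_iff)
  moreover have "S \<noteq> {}"
  proof
    assume "S = {}"
    with S xab have "Inl x = (Inr x :: 'a + 'a)"
      unfolding resolving_set_def pverts_functigraph by (metis UnCI empty_iff imageI)
    then show False by simp
  qed
  then have "card S \<noteq> 0" using S by simp
  ultimately show "2 \<le> card S" by linarith
qed

section \<open>The upper bound, by the number of values of \<open>f\<close>\<close>

lemma metric_dim_le_constant:
  assumes w: "w \<in> pverts G" and const: "\<And>u. u \<in> pverts G \<Longrightarrow> f u = w"
  shows "metric_dim (functigraph G f) \<le> card (pverts (functigraph G f)) - 3"
proof -
  obtain t where t: "(w, t) \<in> parcs G" "t \<in> pverts G" "t \<noteq> w" using w by (rule neighbour)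
  obtain v where v: "v \<in> pverts G" "v \<noteq> w" "v \<noteq> t" by (rule third_vertex)
  obtain b where b: "(w, b) \<in> parcs G" "b \<in> pverts G" "b \<noteq> w" using w by (rule neighbour)
  \<comment> \<open>\<open>Inr t\<close> separates \<open>Inl w\<close> from \<open>Inr w\<close>.
    \<open>Inl b\<close> is adjacent to both \<open>Inl w\<close> and \<open>Inr w\<close> but not
    to \<open>Inr v\<close>, which lies outside the image and has no neighbour in the first
    copy.\<close>
  show ?thesis
    using w v t b const
    by (intro C.metric_dim_le_card_diff_3[of "Inl w" "Inr w" "Inr v"])
      (auto simp: pverts_functigraph intro: bexI[of _ "Inr t"] bexI[of _ "Inl b"])
qed

text \<open>Each of the three vertices has its own single neighbour in the second copy.\<close>

lemma metric_dim_le_three_values: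
  assumes "a \<in> pverts G" "b \<in> pverts G" "c \<in> pverts G" "f a \<noteq> f b" "f a \<noteq> f c" "f b \<noteq> f c"
  shows "metric_dim (functigraph G f) \<le> card (pverts (functigraph G f)) - 3"
  using assms
  by (intro C.metric_dim_le_card_diff_3[of "Inl a" "Inl b" "Inl c"])
    (auto simp: pverts_functigraph intro: bexI[of _ "Inr (f a)"] bexI[of _ "Inr (f b)"])

text \<open>\<open>Inr r\<close> sees both or neither of \<open>Inr (f a)\<close> and
  \<open>Inr (f b)\<close>, whereas \<open>Inl a\<close> and \<open>Inl b\<close> each see exactly
  one.\<close>

lemma metric_dim_le_two_values_not_separated:
  assumes ab: "a \<in> pverts G" "b \<in> pverts G" "f a \<noteq> f b"
    and r: "r \<in> pverts G" "r \<noteq> f a" "r \<noteq> f b"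
    and sep: "(r, f a) \<in> parcs G \<longleftrightarrow> (r, f b) \<in> parcs G"
  shows "metric_dim (functigraph G f) \<le> card (pverts (functigraph G f)) - 3"
proof (rule C.metric_dim_le_card_diff_3[of "Inl a" "Inl b" "Inr r"])
  show "\<exists>s\<in>pverts (functigraph G f) - {Inl a, Inl b, Inr r}.
      ((Inl a, s) \<in> parcs (functigraph G f)) \<noteq> ((Inr r, s) \<in> parcs (functigraph G f))"
    using assms by (cases "(r, f b) \<in> parcs G")
      (auto simp: pverts_functigraph intro: bexI[of _ "Inr (f a)"] bexI[of _ "Inr (f b)"])
  show "\<exists>s\<in>pverts (functigraph G f) - {Inl a, Inl b, Inr r}.
      ((Inl b, s) \<in> parcs (functigraph G f)) \<noteq> ((Inr r, s) \<in> parcs (functigraph G f))"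
    using assms by (cases "(r, f b) \<in> parcs G")
      (auto simp: pverts_functigraph intro: bexI[of _ "Inr (f a)"] bexI[of _ "Inr (f b)"])
qed (use assms in \<open>auto simp: pverts_functigraph intro: bexI[of _ "Inr (f a)"]\<close>)

lemma metric_dim_le_two_values_separated:
  assumes ab: "a \<in> pverts G" "b \<in> pverts G" "f a \<noteq> f b"
    and range: "\<And>u. u \<in> pverts G \<Longrightarrow> f u = f a \<or> f u = f b"
    and r: "r \<in> pverts G" "r \<noteq> f a" "r \<noteq> f b" "(r, f a) \<in> parcs G" "(r, f b) \<notin> parcs G"
  shows "metric_dim (functigraph G f) \<le> card (pverts (functigraph G f)) - 3"
\<comment> \<open>\<open>Inl a\<close> and \<open>Inr r\<close> agree on \<open>Inr (f a)\<close>
  and \<open>Inr (f b)\<close>. They are told apart in the first copy, where \<open>Inr r\<close>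
  has no neighbour, by a neighbour of a preimage of \<open>f a\<close> that lies outside the
  triple.\<close>
proof (cases "\<exists>a' b' c. a' \<in> pverts G \<and> b' \<in> pverts G \<and> f a' = f a \<and> f b' = f b \<and>
    (a', c) \<in> parcs G \<and> c \<noteq> b'")
  case True
  then obtain a' b' c where ab': "a' \<in> pverts G" "b' \<in> pverts G" "f a' = f a" "f b' = f b"
    and c: "(a', c) \<in> parcs G" "c \<noteq> b'" by blast
  have "c \<in> pverts G" "c \<noteq> a'" using c in_arcsD2 no_loops' by blast+
  have "r \<noteq> f c" using range[OF \<open>c \<in> pverts G\<close>] r by auto
  show ?thesis
  proof (rule C.metric_dim_le_card_diff_3[of "Inl a'" "Inl b'" "Inr r"])
    show "\<exists>s\<in>pverts (functigraph G f) - {Inl a', Inl b', Inr r}.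
        ((Inl a', s) \<in> parcs (functigraph G f)) \<noteq> ((Inr r, s) \<in> parcs (functigraph G f))"
      using c \<open>c \<in> pverts G\<close> \<open>c \<noteq> a'\<close> \<open>r \<noteq> f c\<close>
      by (intro bexI[of _ "Inl c"]) (auto simp: pverts_functigraph)
  qed (use ab ab' r in \<open>auto simp: pverts_functigraph intro: bexI[of _ "Inr (f a)"]\<close>)
next
  case False
  \<comment> \<open>Then \<open>G\<close> is a star with centre \<open>b\<close>, all of whose leaves are mapped to \<open>f a\<close>.\<close>
  then have star: "c = b'" if "a' \<in> pverts G" "b' \<in> pverts G" "f a' = f a" "f b' = f b"
    "(a', c) \<in> parcs G" for a' b' c using that by blast
  obtain d where "(a, d) \<in> parcs G" using neighbour[OF ab(1)] by blast
  \<comment> \<open>The neighbour \<open>d\<close> of \<open>a\<close> equals every preimage of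
    \<open>f b\<close> at once.\<close>
  then have only_b: "b' = b" if "b' \<in> pverts G" "f b' = f b" for b'
    using star[OF ab(1) that(1) refl that(2)] star[OF ab(1,2) refl refl] by simp
  obtain a' where a': "a' \<in> pverts G" "a' \<noteq> a" "a' \<noteq> b" by (rule third_vertex)
  then have fa': "f a' = f a" using range[OF a'(1)] only_b[OF a'(1)] by auto
  have adj: "(u, b) \<in> parcs G" if u: "u \<in> pverts G" "f u = f a" for u
  proof -
    obtain d where "(u, d) \<in> parcs G" using neighbour[OF u(1)] by blast
    moreover from this have "d = b" using star[OF u(1) ab(2) u(2) refl] by simp
    ultimately show ?thesis by simp
  qed
  have nadj: "(a, a') \<notin> parcs G" using star[OF ab(1,2) refl refl, of a'] a'(3) by auto
  have adj': "(a, b) \<in> parcs G" "(b, a') \<in> parcs G" "(a', b) \<in> parcs G"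
    using adj[OF ab(1) refl] adj[OF a'(1) fa'] by (auto intro: arcs_symmetric)
  have "a \<noteq> b" using ab by blast
  show ?thesis
  \<comment> \<open>A second leaf \<open>a'\<close> is adjacent to the centre \<open>b\<close> but
    not to \<open>a\<close>, and \<open>Inl a'\<close> is joined to \<open>Inr (f a)\<close>;
    \<open>Inr r\<close> separates the remaining pair.\<close>
  proof (rule C.metric_dim_le_card_diff_3[of "Inl b" "Inl a" "Inr (f a)"])
    show "\<exists>s\<in>pverts (functigraph G f) - {Inl b, Inl a, Inr (f a)}.
        ((Inl b, s) \<in> parcs (functigraph G f)) \<noteq> ((Inl a, s) \<in> parcs (functigraph G f))"
      using a' adj' nadj by (intro bexI[of _ "Inl a'"]) (auto simp: pverts_functigraph)
    show "\<exists>s\<in>pverts (functigraph G f) - {Inl b, Inl a, Inr (f a)}.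
        ((Inl b, s) \<in> parcs (functigraph G f)) \<noteq> ((Inr (f a), s) \<in> parcs (functigraph G f))"
      using r arcs_symmetric[OF r(4)] by (intro bexI[of _ "Inr r"]) (auto simp: pverts_functigraph)
    show "\<exists>s\<in>pverts (functigraph G f) - {Inl b, Inl a, Inr (f a)}.
        ((Inl a, s) \<in> parcs (functigraph G f)) \<noteq> ((Inr (f a), s) \<in> parcs (functigraph G f))"
      using a' nadj fa' by (intro bexI[of _ "Inl a'"]) (auto simp: pverts_functigraph)
  qed (use ab \<open>a \<noteq> b\<close> in \<open>auto simp: pverts_functigraph\<close>)
qed

lemma metric_dim_functigraph_le: "metric_dim (functigraph G f) \<le> 2 * card (pverts G) - 3"
proof -
  obtain a where a: "a \<in> pverts G" by (rule third_vertex)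
  have "metric_dim (functigraph G f) \<le> card (pverts (functigraph G f)) - 3"
  proof (cases "\<forall>u\<in>pverts G. f u = f a")
    case True
    then show ?thesis using a f_in by (intro metric_dim_le_constant[of "f a"]) blast+
  next
    case False
    then obtain b where b: "b \<in> pverts G" "f a \<noteq> f b" by metis
    show ?thesis
    proof (cases "\<forall>u\<in>pverts G. f u = f a \<or> f u = f b")
      case False
      then obtain c where "c \<in> pverts G" "f a \<noteq> f c" "f b \<noteq> f c" by metis
      with a b show ?thesis by (intro metric_dim_le_three_values[of a b c])
    next
      case True
      \<comment> \<open>With only two values and at least three vertices, some \<open>r\<close> lies
        outside the image of \<open>f\<close>.\<close>
      obtain r where r: "r \<in> pverts G" "r \<noteq> f a" "r \<noteq> f b" by (rule third_vertex)
      consider "(r, f a) \<in> parcs G \<longleftrightarrow> (r, f b) \<in> parcs G"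
        | "(r, f a) \<in> parcs G" "(r, f b) \<notin> parcs G"
        | "(r, f b) \<in> parcs G" "(r, f a) \<notin> parcs G" by blast
      then show ?thesis
      proof cases
        case 1
        with a b r show ?thesis by (intro metric_dim_le_two_values_not_separated[of a b r])
      next
        case 2
        with a b r True show ?thesis by (intro metric_dim_le_two_values_separated[of a b r]) metis+
      next
        case 3
        with a b r True show ?thesis by (intro metric_dim_le_two_values_separated[of b a r]) metis+
      qed
    qed
  qed
  then show ?thesis by (simp add: card_pverts_functigraph)
qed

end

section \<open>Sharpness\<close>

definition K3 :: "nat pair_pre_digraph" where
  "K3 = \<lparr> pverts = {0, 1, 2}, parcs = {(0, 1), (0, 2), (1, 0), (1, 2), (2, 0), (2, 1)} \<rparr>"

lemma K3_simps [simp]: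
  "pverts K3 = {0, 1, 2}" "parcs K3 = {(0, 1), (0, 2), (1, 0), (1, 2), (2, 0), (2, 1)}"
  by (simp_all add: K3_def)

lemma pair_graph_K3: "pair_graph K3"
  by unfold_locales (auto simp: symmetric_def intro!: symI)

lemma connected_K3: "connected (with_proj K3)"
proof -
  interpret pair_graph K3 by (rule pair_graph_K3)
  have "u \<rightarrow>\<^sup>*\<^bsub>with_proj K3\<^esub> v" if "u \<in> {0, 1, 2}" "v \<in> {0, 1, 2}" for u v
  proof (cases "u = v")
    case True
    then show ?thesis using that by simp
  next
    case False
    then show ?thesis using that by (intro reachable_adjI) auto
  qed
  then show ?thesis
    \<comment> \<open>\<open>connected\<close> refers to the symmetric closure, which adds nothing
      to symmetric arcs.\<close>
    using reachable_mk_symmetric_eq[OF pair_sym_arcs] by (intro connectedI) simp_all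
qed

lemma functi_K3: "f \<in> {0, 1, 2} \<rightarrow> {0, 1, 2} \<Longrightarrow> functi K3 f"
  using pair_graph_K3 connected_K3 by (simp add: functi_def functi_axioms_def)

lemma metric_dim_prism: "metric_dim (functigraph K3 id) = 2"
proof (rule antisym)
  interpret functi K3 id by (rule functi_K3) auto
  show "2 \<le> metric_dim (functigraph K3 id)" by (rule metric_dim_functigraph_ge_2)
  \<comment> \<open>The other vertices \<open>Inl 2\<close>, \<open>Inr 0\<close>,
    \<open>Inr 1\<close>, \<open>Inr 2\<close> are adjacent to both, only the first, only the
    second, and neither of these two.\<close>
  have "resolving_set (functigraph K3 id) {Inl 0, Inl 1}"
    by (rule C.resolving_set_adjI) (auto simp: pverts_functigraph)
  then show "metric_dim (functigraph K3 id) \<le> 2"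
    using metric_dim_le by fastforce
qed

text \<open>\<open>Inl 0\<close>, \<open>Inl 1\<close>, \<open>Inl 2\<close> are pairwise twins, all
  adjacent to \<open>Inr 0\<close>, and so are \<open>Inr 1\<close> and \<open>Inr 2\<close>. A
  resolving set thus contains two vertices of the first class and one of the second.\<close>

lemma metric_dim_functigraph_K3_constant: "metric_dim (functigraph K3 (\<lambda>_. 0)) = 3"
proof (rule antisym)
  interpret functi K3 "\<lambda>_. 0" by (rule functi_K3) auto
  show "metric_dim (functigraph K3 (\<lambda>_. 0)) \<le> 3"
    using metric_dim_functigraph_le by simp
  show "3 \<le> metric_dim (functigraph K3 (\<lambda>_. 0))"
  proof (rule C.metric_dim_ge)
    fix S :: "(nat + nat) set"
    assume S: "finite S" "resolving_set (functigraph K3 (\<lambda>_. 0)) S"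
    have L: "Inl i \<in> S \<or> Inl j \<in> S" if "i \<in> {0, 1, 2}" "j \<in> {0, 1, 2}" "i \<noteq> j" for i j
    proof (rule C.resolving_set_twin[OF S(2)])
      fix z :: "nat + nat"
      assume "z \<noteq> Inl i" "z \<noteq> Inl j"
      then show "(Inl i, z) \<in> parcs (functigraph K3 (\<lambda>_. 0)) \<longleftrightarrow>
          (Inl j, z) \<in> parcs (functigraph K3 (\<lambda>_. 0))"
        using that by (cases z) auto
    qed (use that in \<open>auto simp: pverts_functigraph\<close>)
    have R: "Inr 1 \<in> S \<or> Inr 2 \<in> S"
    proof (rule C.resolving_set_twin[OF S(2)])
      fix z :: "nat + nat"
      assume "z \<noteq> Inr 1" "z \<noteq> Inr 2"
      then show "(Inr 1, z) \<in> parcs (functigraph K3 (\<lambda>_. 0)) \<longleftrightarrow>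
          (Inr 2, z) \<in> parcs (functigraph K3 (\<lambda>_. 0))"
        by (cases z) auto
    qed (auto simp: pverts_functigraph)
    from L[of 0 1] L[of 0 2] L[of 1 2]
    obtain i j where "Inl i \<in> S" "Inl j \<in> S" "i \<noteq> j" by force
    moreover from R obtain k where "Inr k \<in> S" by blast
    ultimately have "{Inl i, Inl j, Inr k} \<subseteq> S" "card {Inl i, Inl j, Inr k :: nat + nat} = 3"
      by auto
    with S show "3 \<le> card S" by (metis card_mono)
  qed
qed

theorem theorem2p4:
  shows "(\<forall>(G :: 'a pair_pre_digraph) (f :: 'a \<Rightarrow> 'a) n.
            pair_graph G \<longrightarrow> connected (with_proj G) \<longrightarrow> card (pverts G) = n \<longrightarrow> n \<ge> 3 \<longrightarrow>
            f \<in> pverts G \<rightarrow> pverts G \<longrightarrow>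
            2 \<le> metric_dim (functigraph G f) \<and> metric_dim (functigraph G f) \<le> 2 * n - 3)
       \<and> (\<exists>(G :: nat pair_pre_digraph) (f :: nat \<Rightarrow> nat) n.
            pair_graph G \<and> connected (with_proj G) \<and> card (pverts G) = n \<and> n \<ge> 3 \<and>
            f \<in> pverts G \<rightarrow> pverts G \<and>
            metric_dim (functigraph G f) = 2)
       \<and> (\<exists>(G :: nat pair_pre_digraph) (f :: nat \<Rightarrow> nat) n.
            pair_graph G \<and> connected (with_proj G) \<and> card (pverts G) = n \<and> n \<ge> 3 \<and>
            f \<in> pverts G \<rightarrow> pverts G \<and>
            metric_dim (functigraph G f) = 2 * n - 3)"
proof (intro conjI allI impI)
  fix G :: "'a pair_pre_digraph" and f :: "'a \<Rightarrow> 'a" and n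
  assume asm: "pair_graph G" "connected (with_proj G)" "card (pverts G) = n" "3 \<le> n"
    "f \<in> pverts G \<rightarrow> pverts G"
  then interpret functi G f by (simp add: functi_def functi_axioms_def)
  show "2 \<le> metric_dim (functigraph G f)" by (rule metric_dim_functigraph_ge_2)
  show "metric_dim (functigraph G f) \<le> 2 * n - 3" using metric_dim_functigraph_le asm(3) by simp
next
  show "\<exists>(G :: nat pair_pre_digraph) (f :: nat \<Rightarrow> nat) n.
      pair_graph G \<and> connected (with_proj G) \<and> card (pverts G) = n \<and> n \<ge> 3 \<and>
      f \<in> pverts G \<rightarrow> pverts G \<and> metric_dim (functigraph G f) = 2"
    using pair_graph_K3 connected_K3 metric_dim_prism
    by (intro exI[of _ K3] exI[of _ id] exI[of _ 3]) auto
next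
  show "\<exists>(G :: nat pair_pre_digraph) (f :: nat \<Rightarrow> nat) n.
      pair_graph G \<and> connected (with_proj G) \<and> card (pverts G) = n \<and> n \<ge> 3 \<and>
      f \<in> pverts G \<rightarrow> pverts G \<and> metric_dim (functigraph G f) = 2 * n - 3"
    using pair_graph_K3 connected_K3 metric_dim_functigraph_K3_constant
    by (intro exI[of _ K3] exI[of _ "\<lambda>_. 0"] exI[of _ 3]) auto
qed

end
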